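(* For every integer $n\ge 3$, $\tilde{r}(C_3,P_n)\le 3n-4$.
   Context: In the online size Ramsey game $\mathcal R(H_1,H_2)$, played on the edge set of the infinite complete graph $K_{\mathbb N}$, in each round Builder selects a previously unselected edge and Painter colours it red or blue; the game ends as soon as there is a red copy of $H_1$ or a blue copy of $H_2$. Builder tries to end the game as soon as possible, Painter tries to delay it, and $\tilde r(H_1,H_2)$ is the number of rounds under optimal play of both players. $C_3$ is the triangle and $P_n$ is the path on $n$ vertices. *)

theory Defs
  imports Main
begin

text \<open>Online size Ramsey game R(C3, P_n) on K_N. Vertices are natural numbers,
an edge is a 2-element set {u,v} with u \<noteq> v. A game history is the list of
coloured edges chosen so far (most recent first); colour True = red, False = blue.\<close>

type_synonym history = "(nat set \<times> bool) list"

definition has_red_triangle :: "history \<Rightarrow> bool" where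
  "has_red_triangle H \<longleftrightarrow>
     (\<exists>a b c. distinct [a, b, c] \<and> ({a, b}, True) \<in> set H \<and>
              ({b, c}, True) \<in> set H \<and> ({a, c}, True) \<in> set H)"

definition has_blue_path :: "nat \<Rightarrow> history \<Rightarrow> bool" where
  "has_blue_path n H \<longleftrightarrow>
     (\<exists>vs. length vs = n \<and> distinct vs \<and>
           (\<forall>i. Suc i < n \<longrightarrow> ({vs ! i, vs ! Suc i}, False) \<in> set H))"

definition game_over :: "nat \<Rightarrow> history \<Rightarrow> bool" where
  "game_over n H \<longleftrightarrow> has_red_triangle H \<or> has_blue_path n H"

fun builder_wins :: "nat \<Rightarrow> nat \<Rightarrow> history \<Rightarrow> bool" where
  "builder_wins n 0 H = game_over n H"
| "builder_wins n (Suc k) H =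
     (game_over n H \<or>
      (\<exists>u v. u \<noteq> v \<and> {u, v} \<notin> fst ` set H \<and>
             (\<forall>c. builder_wins n k (({u, v}, c) # H))))"

definition online_ramsey_C3_P :: "nat \<Rightarrow> nat" where
  "online_ramsey_C3_P n = (LEAST k. builder_wins n k [])"

end

theory Submission
  imports Defs
begin

text \<open>
  Builder keeps two disjoint blue paths \<open>T = y \<dots> t\<close> and \<open>E = e \<dots> l\<close> whose ends \<open>y\<close>, \<open>l\<close> are joined
  in red, and offers an edge from \<open>t\<close> to a fresh vertex \<open>z\<close>. If it is blue, \<open>T\<close> grows at the cost of one
  edge; otherwise Builder offers \<open>ze\<close>, and a blue answer makes \<open>E\<close> grow at the cost of two edges. If both
  answers are red then \<open>te\<close> must be blue, and the two paths merge into one blue path with its ends joined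
  in red. If they never merge, one of them reaches \<open>n\<close> vertices after about \<open>n + 2n\<close> edges.

  After a merger Builder continues with a single blue path on \<open>k\<close> vertices whose ends are
  adjacent (in either colour) and which spans a red edge. This configuration can be rebuilt on \<open>k + 1\<close>
  vertices with three more edges, and the blue path on \<open>k + 1\<close> vertices already appears after two.

  If the first two edges form a red path, the bookkeeping would be off by one. Builder then keeps a second
  red neighbour \<open>l'\<close> of \<open>y\<close> in reserve: the edge \<open>l'l\<close> is forced to be blue but is only drawn at the end.
\<close>

section \<open>Blue paths\<close>

abbreviation red :: "history \<Rightarrow> nat \<Rightarrow> nat \<Rightarrow> bool" where
  "red H a b \<equiv> ({a, b}, True) \<in> set H"

abbreviation blue :: "history \<Rightarrow> nat \<Rightarrow> nat \<Rightarrow> bool" where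
  "blue H a b \<equiv> ({a, b}, False) \<in> set H"

definition bpath :: "history \<Rightarrow> nat list \<Rightarrow> bool" where
  "bpath H vs \<longleftrightarrow> distinct vs \<and> successively (blue H) vs"

lemma bpath_mono: "bpath H vs \<Longrightarrow> set H \<subseteq> set H' \<Longrightarrow> bpath H' vs"
  unfolding bpath_def by (auto elim!: successively_mono)

lemma bpath_singleton [simp]: "bpath H [v]"
  by (simp add: bpath_def)

lemma bpath_append:
  "xs \<noteq> [] \<Longrightarrow> ys \<noteq> [] \<Longrightarrow>
     bpath H (xs @ ys) \<longleftrightarrow>
       bpath H xs \<and> bpath H ys \<and> set xs \<inter> set ys = {} \<and> blue H (last xs) (hd ys)"
  by (auto simp: bpath_def successively_append_iff)

lemma bpath_Cons:
  "ys \<noteq> [] \<Longrightarrow> bpath H (x # ys) \<longleftrightarrow> bpath H ys \<and> x \<notin> set ys \<and> blue H x (hd ys)"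
  using bpath_append[of "[x]" ys H] by auto

lemma bpath_snoc:
  "xs \<noteq> [] \<Longrightarrow> bpath H (xs @ [y]) \<longleftrightarrow> bpath H xs \<and> y \<notin> set xs \<and> blue H (last xs) y"
  using bpath_append[of xs "[y]" H] by auto

lemma bpath_rev: "bpath H vs \<Longrightarrow> bpath H (rev vs)"
  by (simp add: bpath_def insert_commute)

text \<open>The blue edge between the ends turns the path into a blue cycle, which is cut open just
  before \<open>w\<close>.\<close>

lemma bpath_rotate:
  assumes "bpath H vs" "blue H (last vs) (hd vs)" "w \<in> set vs"
  obtains us where "bpath H us" "set us = set vs" "length us = length vs" "hd us = w" "us \<noteq> []"
proof -
  obtain a b where ab: "vs = a @ w # b" using assms(3) by (meson split_list)
  show thesis
  proof (cases "a = []")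
    case True
    with ab assms that[of vs] show ?thesis by simp
  next
    case False
    have "bpath H (w # b)" "bpath H a" "set a \<inter> set (w # b) = {}"
      using assms(1) False unfolding ab by (auto simp: bpath_append)
    moreover have "blue H (last (w # b)) (hd a)" using assms(2) False unfolding ab by simp
    ultimately have "bpath H ((w # b) @ a)"
      using False by (subst bpath_append) auto
    then show ?thesis using that[of "(w # b) @ a"] ab by auto
  qed
qed

section \<open>Rounds of the game as proof rules\<close>

lemma game_over_bpath:
  assumes "bpath H vs" "n \<le> length vs"
  shows "game_over n H"
proof -
  have "distinct (take n vs)" using assms by (simp add: bpath_def)
  moreover have "\<forall>i. Suc i < n \<longrightarrow> blue H (take n vs ! i) (take n vs ! Suc i)"
    using assms by (auto simp: bpath_def successively_conv_nth)
  ultimately have "has_blue_path n H"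
    unfolding has_blue_path_def using assms(2) by (intro exI[of _ "take n vs"]) simp
  then show ?thesis by (simp add: game_over_def)
qed

lemma builder_wins_over: "game_over n H \<Longrightarrow> builder_wins n r H"
  by (cases r) auto

lemmas wins_bpath = builder_wins_over[OF game_over_bpath]

lemma builder_wins_Suc: "builder_wins n r H \<Longrightarrow> builder_wins n (Suc r) H"
proof (induction r arbitrary: H)
  case 0
  then show ?case by simp
next
  case (Suc r)
  show ?case
  proof (cases "game_over n H")
    case True
    then show ?thesis by (rule builder_wins_over)
  next
    case False
    then obtain u v where "u \<noteq> v" "{u, v} \<notin> fst ` set H" "\<And>c. builder_wins n r (({u, v}, c) # H)"
      using Suc.prems by auto
    then show ?thesis unfolding builder_wins.simps(2)[of n "Suc r"] using Suc.IH by blast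
  qed
qed

text \<open>Redrawing an edge is harmless, so no later argument has to track which edges are still free.\<close>

lemma wins_draw:
  assumes "u \<noteq> v" "0 < r"
    and win: "\<And>H' c. set H \<subseteq> set H' \<Longrightarrow> ({u, v}, c) \<in> set H' \<Longrightarrow> builder_wins n (r - 1) H'"
  shows "builder_wins n r H"
proof -
  obtain k where r: "r = Suc k" using \<open>0 < r\<close> by (cases r) auto
  show ?thesis
  proof (cases "{u, v} \<in> fst ` set H")
    case True
    then obtain c where "({u, v}, c) \<in> set H" by auto
    with win[of H c] r show ?thesis by (simp add: builder_wins_Suc del: builder_wins.simps)
  next
    case False
    moreover have "builder_wins n k (({u, v}, c) # H)" for c
      using win[of "({u, v}, c) # H" c] r by auto
    ultimately show ?thesis using r \<open>u \<noteq> v\<close> by auto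
  qed
qed

lemma wins_draw_cases:
  assumes "u \<noteq> v" "0 < r"
    and "\<And>H'. set H \<subseteq> set H' \<Longrightarrow> red H' u v \<Longrightarrow> builder_wins n (r - 1) H'"
    and "\<And>H'. set H \<subseteq> set H' \<Longrightarrow> blue H' u v \<Longrightarrow> builder_wins n (r - 1) H'"
  shows "builder_wins n r H"
  using assms(1,2)
proof (rule wins_draw)
  fix H' c
  assume "set H \<subseteq> set H'" "({u, v}, c) \<in> set H'"
  with assms(3,4) show "builder_wins n (r - 1) H'" by (cases c) auto
qed

text \<open>A red answer would close a red triangle, so only the blue answer needs a
  continuation.\<close>

lemma wins_force:
  assumes "red H a b" "red H b c" "distinct [a, b, c]" "0 < r"
    and win: "\<And>H'. set H \<subseteq> set H' \<Longrightarrow> blue H' a c \<Longrightarrow> builder_wins n (r - 1) H'"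
  shows "builder_wins n r H"
proof (rule wins_draw_cases)
  fix H'
  assume "set H \<subseteq> set H'" "red H' a c"
  then have "has_red_triangle H'"
    unfolding has_red_triangle_def using assms(1-3) by blast
  then show "builder_wins n (r - 1) H'"
    by (intro builder_wins_over) (simp add: game_over_def)
qed (use assms in auto)

lemma ex_fresh: "finite A \<Longrightarrow> \<exists>z::nat. z \<notin> A"
  by (rule ex_new_if_finite) auto

section \<open>The single path left after a merger\<close>

definition closed_path :: "history \<Rightarrow> nat list \<Rightarrow> bool" where
  "closed_path H vs \<longleftrightarrow> bpath H vs \<and> hd vs \<noteq> last vs \<and> vs \<noteq> [] \<and>
     (red H (hd vs) (last vs) \<or>
      blue H (last vs) (hd vs) \<and> (\<exists>w\<in>set vs. \<exists>t\<in>set vs. w \<noteq> t \<and> red H w t))"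

text \<open>Each new vertex costs three edges: two to attach it, one to join the new ends. The
  \<open>Suc\<close> records that the last of these joining edges is never drawn.\<close>

lemma wins_closed_path:
  assumes "closed_path H vs" "3 * (n - length vs) \<le> Suc r"
  shows "builder_wins n r H"
  using assms
proof (induction "n - length vs" arbitrary: H vs r)
  case 0
  then have "bpath H vs" "n \<le> length vs" by (auto simp: closed_path_def)
  then show ?case by (rule wins_bpath)
next
  case (Suc d)
  have vs: "bpath H vs" "hd vs \<noteq> last vs" "vs \<noteq> []" using Suc.prems by (auto simp: closed_path_def)
  have d: "n - Suc (length vs) = d" "3 * Suc d \<le> Suc r" "n = Suc d + length vs"
    using Suc by auto
  \<comment> \<open>The joining edge: since the longer path spans a red edge, either colour between
    its ends restores \<open>closed_path\<close>.\<close>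
  have close: "builder_wins n s H'"
    if us: "bpath H' us" "length us = Suc (length vs)" and s: "3 * d \<le> s"
      and wt: "w \<in> set us" "t \<in> set us" "w \<noteq> t" "red H' w t" for us H' w t s
  proof (cases "d = 0")
    case True
    then show ?thesis using us d by (intro wins_bpath) auto
  next
    case False
    have "hd us \<noteq> last us"
      using us vs by (cases us) (auto simp: bpath_def)
    have "us \<noteq> []" using us by auto
    show ?thesis
    proof (rule wins_draw_cases)
      fix H'' assume H'': "set H' \<subseteq> set H''"
      have b: "bpath H'' us" using H'' us(1) bpath_mono by blast
      have *: "closed_path H'' us \<Longrightarrow> builder_wins n (s - 1) H''"
        by (rule Suc.hyps(1)[of us]) (use us d s in auto)
      show "builder_wins n (s - 1) H''" if "red H'' (hd us) (last us)"
        using that * b \<open>hd us \<noteq> last us\<close> \<open>us \<noteq> []\<close> by (auto simp: closed_path_def)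
      show "builder_wins n (s - 1) H''" if "blue H'' (hd us) (last us)"
      proof (rule *)
        have "red H'' w t" using wt H'' by auto
        moreover have "blue H'' (last us) (hd us)" using that by (simp add: insert_commute)
        ultimately show "closed_path H'' us"
          using wt(1-3) b \<open>hd us \<noteq> last us\<close> \<open>us \<noteq> []\<close> unfolding closed_path_def by blast
      qed
    qed (use \<open>hd us \<noteq> last us\<close> False s in auto)
  qed
  obtain x where x: "x \<notin> set vs" using ex_fresh[of "set vs"] by auto
  have ends: "hd vs \<in> set vs" "last vs \<in> set vs" using vs by auto
  show ?case
  proof (cases "red H (hd vs) (last vs)")
    case True
    show ?thesis
    proof (rule wins_draw_cases[of "last vs" x])
      fix H' assume H': "set H \<subseteq> set H'"
      have b: "bpath H' vs" "red H' (hd vs) (last vs)" using H' vs(1) bpath_mono True by blast+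
      show "builder_wins n (r - 1) H'" if "blue H' (last vs) x"
      proof (rule close[of _ "vs @ [x]" _ "hd vs" "last vs"])
        show "bpath H' (vs @ [x])" using b x that vs by (simp add: bpath_snoc)
      qed (use b vs ends d in auto)
      show "builder_wins n (r - 1) H'" if "red H' (last vs) x"
      proof (rule wins_force[of "hd vs" "last vs" _ x])
        fix H'' assume H'': "set H' \<subseteq> set H''" and bl: "blue H'' (hd vs) x"
        show "builder_wins n (r - 1 - 1) H''"
        proof (rule close[of _ "x # vs" _ "hd vs" "last vs"])
          show "bpath H'' (x # vs)"
            using b bpath_mono[OF _ H''] bl x vs by (auto simp: bpath_Cons insert_commute)
        qed (use b H'' vs ends d in auto)
      qed (use that b vs x ends d in auto)
    qed (use x ends d in auto)
  next
    case False
    then obtain w t where wt: "w \<in> set vs" "t \<in> set vs" "w \<noteq> t" "red H w t"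
      and cyc: "blue H (last vs) (hd vs)"
      using Suc.prems by (auto simp: closed_path_def)
    \<comment> \<open>On a blue cycle every vertex can serve as an end, so \<open>x\<close> may be
      attached anywhere. Offering \<open>x\<close> to \<open>w\<close> and, after a red answer, to
      \<open>t\<close> yields a blue edge, because \<open>t\<close>, \<open>w\<close>,
      \<open>x\<close> is then a red path.\<close>
    have attach: "builder_wins n s H'"
      if H': "set H \<subseteq> set H'" and v: "v \<in> set vs" "blue H' v x" and s: "3 * d \<le> s" for H' v s
    proof -
      obtain us where us: "bpath H us" "set us = set vs" "length us = length vs" "hd us = v" "us \<noteq> []"
        using bpath_rotate[OF vs(1) cyc v(1)] .
      show ?thesis
      proof (rule close[of _ "x # us" _ w t])
        show "bpath H' (x # us)"
          using us bpath_mono[OF us(1) H'] v x by (auto simp: bpath_Cons insert_commute)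
      qed (use us wt H' s in auto)
    qed
    show ?thesis
    proof (rule wins_draw_cases[of w x])
      fix H' assume H': "set H \<subseteq> set H'"
      show "builder_wins n (r - 1) H'" if "blue H' w x"
        using attach[OF H' wt(1) that] d by auto
      show "builder_wins n (r - 1) H'" if "red H' w x"
      proof (rule wins_force[of t w _ x])
        fix H'' assume H'': "set H' \<subseteq> set H''" and bl: "blue H'' t x"
        show "builder_wins n (r - 1 - 1) H''"
          using attach[OF _ wt(2) bl] H' H'' d by auto
      qed (use that wt H' x d in \<open>auto simp: insert_commute\<close>)
    qed (use x wt d in auto)
  qed
qed

section \<open>Two disjoint blue paths linked in red, and the opening that leads to them\<close>

definition linked_paths :: "history \<Rightarrow> nat list \<Rightarrow> nat list \<Rightarrow> bool" where
  "linked_paths H T E \<longleftrightarrow> T \<noteq> [] \<and> E \<noteq> [] \<and> bpath H T \<and> bpath H E \<and>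
     set T \<inter> set E = {} \<and> red H (hd T) (last E)"

lemma linked_paths_mono: "linked_paths H T E \<Longrightarrow> set H \<subseteq> set H' \<Longrightarrow> linked_paths H' T E"
  unfolding linked_paths_def using bpath_mono by blast

lemma linked_paths_snoc:
  "linked_paths H T E \<Longrightarrow> blue H (last T) z \<Longrightarrow> z \<notin> set T \<union> set E \<Longrightarrow> linked_paths H (T @ [z]) E"
  unfolding linked_paths_def by (auto simp: bpath_snoc)

lemma linked_paths_Cons:
  "linked_paths H T E \<Longrightarrow> blue H z (hd E) \<Longrightarrow> z \<notin> set T \<union> set E \<Longrightarrow> linked_paths H T (z # E)"
  unfolding linked_paths_def by (auto simp: bpath_Cons)

text \<open>The orientation of \<open>T\<close> and \<open>E\<close> makes the red link run between
  the outer ends of \<open>T @ E\<close>.\<close>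

lemma closed_path_join:
  assumes "linked_paths H T E" "blue H (last T) (hd E)"
  shows "closed_path H (T @ E)"
proof -
  have "hd T \<in> set T" "last E \<in> set E" "set T \<inter> set E = {}"
    using assms by (auto simp: linked_paths_def)
  then have "hd T \<noteq> last E" by auto
  then show ?thesis
    using assms unfolding linked_paths_def closed_path_def
    by (simp add: bpath_append)
qed

text \<open>One growing step. By \<open>join\<close>, two red answers either complete a red triangle
  at once or leave, after the forced edge, \<open>r - 3\<close> rounds for the merged path, enough
  for \<open>wins_closed_path\<close>.\<close>

lemma wins_grow_linked_paths:
  assumes L: "linked_paths H T E" and z: "z \<notin> set T \<union> set E" and r: "3 \<le> r"
    and growT: "\<And>H'. set H \<subseteq> set H' \<Longrightarrow> linked_paths H' (T @ [z]) E \<Longrightarrow> builder_wins n (r - 1) H'"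
    and growE: "\<And>H'. set H \<subseteq> set H' \<Longrightarrow> linked_paths H' T (z # E) \<Longrightarrow> red H' (last T) z \<Longrightarrow>
        builder_wins n (r - 2) H'"
    and join: "red H (last T) (hd E) \<or> 3 * (n - (length T + length E)) \<le> r - 2"
  shows "builder_wins n r H"
proof -
  have mem: "last T \<in> set T" "hd E \<in> set E" "set T \<inter> set E = {}"
    using L by (auto simp: linked_paths_def)
  have ne: "last T \<noteq> z" "z \<noteq> hd E" "last T \<noteq> hd E" using mem z by auto
  show ?thesis
  proof (rule wins_draw_cases[of "last T" z])
    fix H' assume H': "set H \<subseteq> set H'"
    note L' = linked_paths_mono[OF L H']
    show "builder_wins n (r - 1) H'" if "blue H' (last T) z"
      using growT[OF H'] linked_paths_snoc[OF L' that z] .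
    show "builder_wins n (r - 1) H'" if red1: "red H' (last T) z"
    proof (rule wins_draw_cases[of z "hd E"])
      fix H'' assume H'': "set H' \<subseteq> set H''"
      note L'' = linked_paths_mono[OF L' H'']
      have r2: "r - 1 - 1 = r - 2" by simp
      show "builder_wins n (r - 1 - 1) H''" if "blue H'' z (hd E)"
        unfolding r2 using growE[OF _ linked_paths_Cons[OF L'' that z]] red1 H' H'' by auto
      show "builder_wins n (r - 1 - 1) H''" if red2: "red H'' z (hd E)"
        using join
      proof
        assume "red H (last T) (hd E)"
        then have "red H'' (last T) (hd E)" "red H'' (last T) z" using red1 H' H'' by auto
        then have "has_red_triangle H''"
          unfolding has_red_triangle_def using red2 ne
          by (intro exI[of _ "last T"] exI[of _ z] exI[of _ "hd E"]) simp
        then show ?thesis by (intro builder_wins_over) (simp add: game_over_def)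
      next
        assume len: "3 * (n - (length T + length E)) \<le> r - 2"
        show ?thesis
        proof (rule wins_force[of "last T" z _ "hd E"])
          fix H3 assume H3: "set H'' \<subseteq> set H3" and "blue H3 (last T) (hd E)"
          then have "closed_path H3 (T @ E)"
            using closed_path_join linked_paths_mono[OF L'' H3] by blast
          then show "builder_wins n (r - 1 - 1 - 1) H3"
            by (rule wins_closed_path) (use len r in auto)
        qed (use red1 red2 H'' ne r in auto)
      qed
    qed (use ne r in auto)
  qed (use ne r in auto)
qed

text \<open>A vertex missing from \<open>T\<close> is worth one round, one missing from
  \<open>E\<close> two. One round is saved because the game ends while one of the paths is still
  incomplete.\<close>

lemma wins_linked_paths:
  assumes "linked_paths H T E" "3 * n \<le> r + 1 + length T + 2 * length E"
  shows "builder_wins n r H"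
  using assms
proof (induction "(n - length T) + (n - length E)" arbitrary: H T E r rule: less_induct)
  case less
  note L = less.prems(1)
  have ne: "T \<noteq> []" "E \<noteq> []" and len: "0 < length T" "0 < length E"
    and bp: "bpath H T" "bpath H E" and link: "red H (hd T) (last E)"
    and disj: "set T \<inter> set E = {}"
    using L by (auto simp: linked_paths_def)
  obtain z where z: "z \<notin> set T \<union> set E" using ex_fresh[of "set T \<union> set E"] by auto
  consider "n \<le> length T \<or> n \<le> length E" | "Suc (length T) = n" "Suc (length E) = n"
    | "length T < n" "length E < n" "Suc (Suc (length T + length E)) < n + n" by linarith
  then show ?case
  proof cases
    case 1
    then show ?thesis using bp wins_bpath by blast
  next
    case 2
    \<comment> \<open>Only two rounds may remain, too few for two red answers and a forced edge.
      Instead a fresh \<open>z\<close> is offered to \<open>hd T\<close>: blue completes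
      \<open>T\<close>, while red forces \<open>z\<close> onto the end of \<open>E\<close> through
      the red path \<open>z\<close>, \<open>hd T\<close>, \<open>last E\<close>.\<close>
    have mem: "hd T \<in> set T" "last E \<in> set E" using ne by auto
    show ?thesis
    proof (rule wins_draw_cases[of z "hd T"])
      fix H' assume H': "set H \<subseteq> set H'"
      show "builder_wins n (r - 1) H'" if "blue H' z (hd T)"
        by (rule wins_bpath[of _ "z # T"]) (use bpath_mono[OF bp(1) H'] that z ne 2 in \<open>auto simp: bpath_Cons\<close>)
      show "builder_wins n (r - 1) H'" if "red H' z (hd T)"
      proof (rule wins_force[of z "hd T" _ "last E"])
        fix H'' assume H'': "set H' \<subseteq> set H''" "blue H'' z (last E)"
        have "bpath H'' (E @ [z])"
          using bpath_mono[OF bp(2), of H''] H' H'' z ne by (auto simp: bpath_snoc insert_commute)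
        then show "builder_wins n (r - 1 - 1) H''"
          by (rule wins_bpath) (use 2 in auto)
      qed (use that link H' mem z disj 2 less.prems(2) in auto)
    qed (use mem z 2 less.prems(2) in auto)
  next
    case 3
    show ?thesis
    proof (rule wins_grow_linked_paths[OF L z])
      show "3 \<le> r" using 3 less.prems(2) by linarith
      show "builder_wins n (r - 1) H'" if "linked_paths H' (T @ [z]) E" for H'
        by (rule less.hyps[OF _ that]) (use 3 less.prems(2) in auto)
      show "builder_wins n (r - 2) H'" if "linked_paths H' T (z # E)" for H'
        by (rule less.hyps[OF _ that]) (use 3 less.prems(2) in auto)
      show "red H (last T) (hd E) \<or> 3 * (n - (length T + length E)) \<le> r - 2"
        using 3 less.prems(2) len by linarith
    qed
  qed
qed

text \<open>The reserve vertex \<open>l\<close> counts as if it already belonged to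
  \<open>E\<close>: the bound is that of \<open>wins_linked_paths\<close> with
  \<open>length E\<close> raised by one. While \<open>T\<close> is a single vertex, this budget may
  not pay for a merger, so a red edge from \<open>hd T\<close> to \<open>hd E\<close> is kept to
  turn two red answers into a triangle.\<close>

lemma wins_linked_paths_reserve:
  assumes "linked_paths H T E" "red H (hd T) l" "l \<notin> set T \<union> set E"
    "length T < n" "Suc (length E) < n"
    "length T = 1 \<Longrightarrow> red H (hd T) (hd E)"
    "3 * n \<le> r + 3 + length T + 2 * length E"
  shows "builder_wins n r H"
  using assms
proof (induction "(n - length T) + (n - length E)" arbitrary: H T E r rule: less_induct)
  case less
  note L = less.prems(1) and l = less.prems(2,3) and r = less.prems(7)
  have ne: "T \<noteq> []" "E \<noteq> []" and len: "0 < length T" "0 < length E"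
    and bp: "bpath H T" "bpath H E" and link: "red H (hd T) (last E)"
    and disj: "set T \<inter> set E = {}"
    using L by (auto simp: linked_paths_def)
  have mem: "hd T \<in> set T" "last E \<in> set E" using ne by auto
  obtain z where z: "z \<notin> insert l (set T \<union> set E)"
    using ex_fresh[of "insert l (set T \<union> set E)"] by auto
  have l_link: "distinct [l, hd T, last E]" "red H l (hd T)"
    using l mem disj by (auto simp: insert_commute)
  show ?case
  proof (cases "Suc (length T) = n \<and> Suc (Suc (length E)) = n")
    case True
    \<comment> \<open>Two rounds finish: a blue \<open>zl\<close> lets \<open>E\<close> gain
      \<open>l\<close> and \<open>z\<close>, since \<open>l\<close> to \<open>last E\<close> is
      forced; a red \<open>zl\<close> forces \<open>z\<close> onto \<open>hd T\<close>.\<close>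
    show ?thesis
    proof (rule wins_draw_cases[of z l])
      fix H' assume H': "set H \<subseteq> set H'"
      show "builder_wins n (r - 1) H'" if "blue H' z l"
      proof (rule wins_force[of l "hd T" _ "last E"])
        fix H'' assume H'': "set H' \<subseteq> set H''" "blue H'' l (last E)"
        have "bpath H'' (z # l # rev E)"
          using bpath_rev[OF bpath_mono[OF bp(2), of H'']] H' H'' that z l ne
          by (auto simp: bpath_Cons hd_rev)
        then show "builder_wins n (r - 1 - 1) H''"
          by (rule wins_bpath) (use True in auto)
      qed (use l_link link H' True r in auto)
      show "builder_wins n (r - 1) H'" if "red H' z l"
      proof (rule wins_force[of z l _ "hd T"])
        fix H'' assume H'': "set H' \<subseteq> set H''" "blue H'' z (hd T)"
        have "bpath H'' (z # T)"
          using bpath_mono[OF bp(1), of H''] H' H'' z ne by (auto simp: bpath_Cons)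
        then show "builder_wins n (r - 1 - 1) H''"
          by (rule wins_bpath) (use True in auto)
      qed (use that l_link z mem H' True r in auto)
    qed (use z True r in auto)
  next
    case False
    have zTE: "z \<notin> set T \<union> set E" using z by auto
    show ?thesis
    proof (rule wins_grow_linked_paths[OF L zTE])
      show "3 \<le> r" using False less.prems by linarith
      fix H' assume H': "set H \<subseteq> set H'"
      show "builder_wins n (r - 1) H'" if L': "linked_paths H' (T @ [z]) E"
      proof (cases "Suc (length T) = n")
        case True
        show ?thesis
          by (rule wins_bpath[of _ "T @ [z]"]) (use L' True in \<open>auto simp: linked_paths_def\<close>)
      next
        case nT: False
        show ?thesis
          by (rule less.hyps[OF _ L']) (use nT less.prems H' z ne in auto)
      qed
      show "builder_wins n (r - 2) H'" if L': "linked_paths H' T (z # E)" and tz: "red H' (last T) z"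
      proof (cases "Suc (Suc (length E)) = n")
        case True
        \<comment> \<open>Now \<open>z # E\<close> lacks one vertex, and the forced edge from
          \<open>last E\<close> to \<open>l\<close> supplies it.\<close>
        show ?thesis
        proof (rule wins_force[of l "hd T" _ "last E"])
          fix H'' assume H'': "set H' \<subseteq> set H''" "blue H'' l (last E)"
          have "bpath H'' (l # rev (z # E))"
            using bpath_rev[OF bpath_mono[of H' "z # E" H'']] L' H'' z l ne
            by (auto simp: bpath_Cons hd_rev linked_paths_def simp del: rev.simps)
          then show "builder_wins n (r - 2 - 1) H''"
            by (rule wins_bpath) (use True in auto)
        qed (use l_link link H' True False less.prems in auto)
      next
        case nE: False
        show ?thesis
        proof (rule less.hyps[OF _ L'])
          show "red H' (hd T) (hd (z # E))" if "length T = 1"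
            using tz that by (cases T) auto
        qed (use nE less.prems H' z in auto)
      qed
    next
      have "red H (last T) (hd E)" if "length T = 1"
        using less.prems(6)[OF that] that by (cases T) auto
      moreover have "3 * (n - (length T + length E)) \<le> r - 2" if "length T \<noteq> 1"
        using that len r less.prems(4,5) by linarith
      ultimately show "red H (last T) (hd E) \<or> 3 * (n - (length T + length E)) \<le> r - 2"
        by blast
    qed
  qed
qed

text \<open>A blue path grows one edge per vertex until a fresh vertex \<open>z\<close> is answered
  red; a further edge \<open>wz\<close> then sets up two linked paths.\<close>

lemma wins_bpath_opening:
  assumes "bpath H T" "T \<noteq> []" "3 * n \<le> r + 3 + length T" "3 \<le> n"
  shows "builder_wins n r H"
  using assms
proof (induction "n - length T" arbitrary: H T r)
  case 0
  then show ?case by (intro wins_bpath[of H T]) auto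
next
  case (Suc d)
  note bp = Suc.prems(1) and ne = Suc.prems(2) and r = Suc.prems(3)
  have lt: "length T < n" "0 < length T" using Suc by auto
  then have r2: "2 \<le> r" using r by linarith
  obtain z where z: "z \<notin> set T" using ex_fresh[of "set T"] by auto
  obtain w where w: "w \<notin> insert z (set T)" using ex_fresh[of "insert z (set T)"] by auto
  have y: "hd T \<in> set T" using ne by simp
  show ?case
  proof (rule wins_draw_cases[of z "hd T"])
    fix H' assume H': "set H \<subseteq> set H'"
    note bp' = bpath_mono[OF bp H']
    show "builder_wins n (r - 1) H'" if "blue H' z (hd T)"
      by (rule Suc.hyps(1)[of "z # T"]) (use Suc.hyps(2) bp' that z ne r lt \<open>3 \<le> n\<close> in \<open>auto simp: bpath_Cons\<close>)
    show "builder_wins n (r - 1) H'" if zy: "red H' z (hd T)"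
    proof (rule wins_draw_cases[of w z])
      fix H'' assume H'': "set H' \<subseteq> set H''"
      note bp'' = bpath_mono[OF bp' H'']
      have zy'': "red H'' z (hd T)" using zy H'' by auto
      show "builder_wins n (r - 1 - 1) H''" if "blue H'' w z"
      proof (rule wins_linked_paths[of _ T "[w, z]"])
        show "linked_paths H'' T [w, z]"
          using bp'' ne that zy'' z w by (auto simp: linked_paths_def bpath_Cons insert_commute)
      qed (use r lt in auto)
      show "builder_wins n (r - 1 - 1) H''" if wz: "red H'' w z"
      proof (cases "length T = 1")
        \<comment> \<open>Here forcing \<open>w\<close> onto \<open>T\<close> would exceed the
          budget by one round, so \<open>w\<close> becomes the reserve neighbour of
          \<open>z\<close>.\<close>
        case True
        then obtain y where T: "T = [y]" by (cases T) auto
        show ?thesis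
          by (rule wins_linked_paths_reserve[of _ "[z]" "[y]" w])
            (use T zy'' wz z w r \<open>3 \<le> n\<close> in \<open>auto simp: linked_paths_def insert_commute\<close>)
      next
        case False
        then have len2: "2 \<le> length T" using lt by linarith
        show ?thesis
        proof (rule wins_force[of w z _ "hd T"])
          fix H3 assume H3: "set H'' \<subseteq> set H3" "blue H3 w (hd T)"
          have wT: "bpath H3 (w # T)" using bpath_mono[OF bp'' H3(1)] H3 w ne by (auto simp: bpath_Cons)
          show "builder_wins n (r - 1 - 1 - 1) H3"
          \<comment> \<open>The long path takes the role of \<open>E\<close>, whose vertices count
            double; with \<open>length T\<close> at least 2 this pays for the forced edge.\<close>
          proof (rule wins_linked_paths[of _ "[z]" "rev (w # T)"])
            show "linked_paths H3 [z] (rev (w # T))"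
              using bpath_rev[OF wT] wz H3 z w by (auto simp: linked_paths_def insert_commute)
          qed (use r lt len2 in auto)
        qed (use wz zy'' z w y r lt len2 in auto)
      qed
    qed (use z w r2 in auto)
  qed (use y z r2 in auto)
qed

theorem theorem2:
  fixes n :: nat
  assumes "n \<ge> 3"
  shows "online_ramsey_C3_P n \<le> 3 * n - 4"
proof -
  have "builder_wins n (3 * n - 4) []"
    \<comment> \<open>A single vertex is a blue path obtained for free, and
      \<open>3 * n = (3 * n - 4) + 3 + 1\<close>.\<close>
    by (rule wins_bpath_opening[of _ "[0]"]) (use assms in auto)
  then show ?thesis
    unfolding online_ramsey_C3_P_def by (rule Least_le)
qed

end
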